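(* Let $n\geq 3$. Then $\mathrm{rank}(\mathsf{L}_{1})=\mathrm{rank}(\mathsf{L}_{n})=2n-3$.
   Context: For a positive integer $n$, let $X_n=\{1<2<\cdots<n\}$ and let $\mathcal{O}_n$ be the semigroup of all order-preserving maps $\alpha: X_n\to X_n$ (i.e. $x<y$ implies $x\alpha\leq y\alpha$) under composition. Maps are written on the right and composed left to right: $x(\alpha\beta)=(x\alpha)\beta$. For $1\leq k\leq n$, $\pi_k\in\mathcal{O}_n$ is the constant map $x\pi_k=k$ for all $x\in X_n$, and $$\mathsf{L}_{k} = \{ \alpha \in \mathcal{O}_{n} : \alpha \beta= \pi_{k} \text{ for some } \beta\in \mathcal{O}_{n}\setminus\{\pi_k\} \},$$ which is a subsemigroup of $\mathcal{O}_n$. For a semigroup $S$, $\langle A\rangle$ denotes the smallest subsemigroup of $S$ containing the non-empty subset $A$, and $\mathrm{rank}(S)=\min\{\lvert A\rvert : S=\langle A\rangle\}$. *)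

theory Defs
  imports "HOL-Library.FuncSet"
begin

section \<open>Subsemigroups and rank\<close>

text \<open>A semigroup is given by a carrier set and a multiplication that is only relevant on
  the carrier.\<close>

definition subsemigroup :: "'a set \<Rightarrow> ('a \<Rightarrow> 'a \<Rightarrow> 'a) \<Rightarrow> 'a set \<Rightarrow> bool" where
  "subsemigroup S mul T \<longleftrightarrow> T \<noteq> {} \<and> T \<subseteq> S \<and> (\<forall>x\<in>T. \<forall>y\<in>T. mul x y \<in> T)"

definition generated_subsemigroup :: "'a set \<Rightarrow> ('a \<Rightarrow> 'a \<Rightarrow> 'a) \<Rightarrow> 'a set \<Rightarrow> 'a set" where
  "generated_subsemigroup S mul A = \<Inter> {T. subsemigroup S mul T \<and> A \<subseteq> T}"

text \<open>Meant for finitely generated semigroups. The requirement \<open>finite A\<close> is needed because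
  \<open>card\<close> is \<open>0\<close> on infinite sets.\<close>

definition semigroup_rank :: "'a set \<Rightarrow> ('a \<Rightarrow> 'a \<Rightarrow> 'a) \<Rightarrow> nat" where
  "semigroup_rank S mul =
    (LEAST m. \<exists>A. A \<subseteq> S \<and> A \<noteq> {} \<and> finite A \<and> card A = m \<and> generated_subsemigroup S mul A = S)"

section \<open>Order-preserving maps of a finite chain\<close>

text \<open>Maps of the chain \<open>{1..n}\<close> are extensional functions (\<open>undefined\<close> outside \<open>{1..n}\<close>),
  so that equality of maps is equality of functions.\<close>

definition order_preserving_maps :: "nat \<Rightarrow> (nat \<Rightarrow> nat) set" where
  "order_preserving_maps n = {\<alpha> \<in> {1..n} \<rightarrow>\<^sub>E {1..n}. mono_on {1..n} \<alpha>}"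

text \<open>Maps are composed from left to right: \<open>map_mult n \<alpha> \<beta>\<close> applies \<open>\<alpha>\<close> first.\<close>

definition map_mult :: "nat \<Rightarrow> (nat \<Rightarrow> nat) \<Rightarrow> (nat \<Rightarrow> nat) \<Rightarrow> (nat \<Rightarrow> nat)" where
  "map_mult n \<alpha> \<beta> = compose {1..n} \<beta> \<alpha>"

definition const_map :: "nat \<Rightarrow> nat \<Rightarrow> (nat \<Rightarrow> nat)" where
  "const_map n k = (\<lambda>x\<in>{1..n}. k)"

definition left_divisors :: "nat \<Rightarrow> nat \<Rightarrow> (nat \<Rightarrow> nat) set" where
  "left_divisors n k = {\<alpha> \<in> order_preserving_maps n.
     \<exists>\<beta> \<in> order_preserving_maps n - {const_map n k}. map_mult n \<alpha> \<beta> = const_map n k}"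

lemma map_mult_closed:
  assumes "\<alpha> \<in> order_preserving_maps n" "\<beta> \<in> order_preserving_maps n"
  shows "map_mult n \<alpha> \<beta> \<in> order_preserving_maps n"
  using assms unfolding order_preserving_maps_def map_mult_def
  by (auto simp: compose_def mono_on_def PiE_iff)

lemma map_mult_assoc:
  assumes "\<alpha> \<in> order_preserving_maps n"
  shows "map_mult n (map_mult n \<alpha> \<beta>) \<gamma> = map_mult n \<alpha> (map_mult n \<beta> \<gamma>)"
  using assms unfolding order_preserving_maps_def map_mult_def
  by (auto simp: compose_def PiE_iff fun_eq_iff)

lemma left_divisors_mult_closed:
  assumes "k \<in> {1..n}" "\<alpha> \<in> left_divisors n k" "\<gamma> \<in> left_divisors n k"
  shows "map_mult n \<alpha> \<gamma> \<in> left_divisors n k"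
proof -
  obtain \<delta> where \<delta>: "\<delta> \<in> order_preserving_maps n - {const_map n k}"
      "map_mult n \<gamma> \<delta> = const_map n k"
    using assms(3) by (auto simp: left_divisors_def)
  have \<alpha>: "\<alpha> \<in> order_preserving_maps n" and \<gamma>: "\<gamma> \<in> order_preserving_maps n"
    using assms by (auto simp: left_divisors_def)
  have "map_mult n \<alpha> (const_map n k) = const_map n k"
    using \<alpha> by (auto simp: map_mult_def const_map_def compose_def order_preserving_maps_def
        PiE_iff fun_eq_iff)
  then have "map_mult n (map_mult n \<alpha> \<gamma>) \<delta> = const_map n k"
    using \<delta>(2) map_mult_assoc[OF \<alpha>] by simp
  then show ?thesis
    using \<delta>(1) map_mult_closed[OF \<alpha> \<gamma>] by (auto simp: left_divisors_def)
qed

lemma left_divisors_subsemigroup: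
  assumes "k \<in> {1..n}" "n \<ge> 2"
  shows "subsemigroup (order_preserving_maps n) (map_mult n) (left_divisors n k)"
proof -
  have const: "const_map n j \<in> order_preserving_maps n" if "j \<in> {1..n}" for j
    using that by (auto simp: order_preserving_maps_def const_map_def mono_on_def)
  define \<iota> where "\<iota> = (\<lambda>x\<in>{1..n}. x)"
  have \<iota>: "\<iota> \<in> order_preserving_maps n"
    by (auto simp: order_preserving_maps_def \<iota>_def mono_on_def)
  have "\<iota> \<noteq> const_map n k"
  proof
    assume "\<iota> = const_map n k"
    then have "\<iota> 1 = const_map n k 1" "\<iota> 2 = const_map n k 2" by simp_all
    then show False using assms by (simp add: \<iota>_def const_map_def)
  qed
  moreover have "map_mult n (const_map n k) \<iota> = const_map n k"
    using assms(1) by (auto simp: map_mult_def compose_def const_map_def \<iota>_def fun_eq_iff)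
  ultimately have "const_map n k \<in> left_divisors n k"
    using \<iota> const[OF assms(1)] by (auto simp: left_divisors_def)
  then show ?thesis
    using left_divisors_mult_closed[OF assms(1)]
    by (auto simp: subsemigroup_def left_divisors_def)
qed

end

theory Submission
  imports Defs
begin

text \<open>
  A map lies in \<open>left_divisors n 1\<close> iff its image omits the top element \<open>n\<close>, since an
  order-preserving \<open>\<beta> \<noteq> \<pi>\<^sub>1\<close> has \<open>\<beta> n > 1\<close> but may send every smaller point to \<open>1\<close>.
  So this semigroup consists of the order-preserving maps from \<open>{1..n}\<close> to \<open>{1..n-1}\<close>.

  Two kinds of elements force a generating set to be large. The \<open>n - 1\<close> surjections onto
  \<open>{1..n-1}\<close> are the maps \<open>merge n i\<close>, which identify \<open>i\<close> with \<open>i + 1\<close>. The left factor of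
  such a map has at least as large an image and no coarser kernel, hence equals it; so all of
  them are generators (\<open>merge_left_factor\<close>). For \<open>j \<le> n - 2\<close>, a product whose image is
  \<open>{1..n-1} - {j}\<close> has a factor with this very image: a right factor with a larger image would
  have to hit all of \<open>{1..n-1}\<close>, and the point \<open>n - 1\<close> in the image of the product makes it the
  identity on \<open>{1..n-1}\<close> (\<open>image_omitting_one_point_factor\<close>). This gives \<open>n - 2\<close> further
  generators, so the rank is at least \<open>2 * n - 3\<close>.

  Conversely, add to the maps \<open>merge n i\<close> the \<open>n - 2\<close> maps \<open>bump n j\<close>, which move \<open>j\<close> up to
  \<open>j + 1\<close>. A map whose image is an initial segment is a product of merges, by splitting its
  kernel classes one at a time (\<open>generate_initial_segment\<close>). Any other map has a value \<open>v + 1\<close>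
  above an omitted \<open>v\<close>, and arises by \<open>bump n v\<close> from the smaller map in which \<open>v\<close> replaces
  \<open>v + 1\<close> (\<open>generate_all\<close>).

  Finally, reversing the chain is an automorphism that exchanges \<open>left_divisors n 1\<close> with
  \<open>left_divisors n n\<close>, and the rank is invariant under isomorphism.
\<close>

section \<open>Generating sets and isomorphisms\<close>

lemma generated_subsemigroup_eq_iff:
  assumes "S \<noteq> {}" and "\<And>x y. x \<in> S \<Longrightarrow> y \<in> S \<Longrightarrow> mul x y \<in> S" and "A \<subseteq> S"
  shows "generated_subsemigroup S mul A = S \<longleftrightarrow> (\<forall>U. subsemigroup S mul U \<and> A \<subseteq> U \<longrightarrow> U = S)"
proof
  assume "generated_subsemigroup S mul A = S"
  then have "S \<subseteq> U" if "subsemigroup S mul U" "A \<subseteq> U" for U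
    using that unfolding generated_subsemigroup_def by blast
  moreover have "U \<subseteq> S" if "subsemigroup S mul U" for U
    using that by (simp add: subsemigroup_def)
  ultimately show "\<forall>U. subsemigroup S mul U \<and> A \<subseteq> U \<longrightarrow> U = S"
    by (intro allI impI subset_antisym) simp_all
next
  assume *: "\<forall>U. subsemigroup S mul U \<and> A \<subseteq> U \<longrightarrow> U = S"
  have "subsemigroup S mul S" using assms by (simp add: subsemigroup_def)
  with * assms(3) have "{U. subsemigroup S mul U \<and> A \<subseteq> U} = {S}" by blast
  then show "generated_subsemigroup S mul A = S"
    by (simp add: generated_subsemigroup_def)
qed

text \<open>An isomorphism carries subsemigroups to subsemigroups in both directions, by images and
  preimages; so \<open>A\<close> lies in a proper subsemigroup iff its image does.\<close>

lemma generates_iso_image: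
  assumes bij: "bij_betw f S T"
    and hom: "\<And>x y. x \<in> S \<Longrightarrow> y \<in> S \<Longrightarrow> f (mul x y) = mul' (f x) (f y)"
    and ne: "S \<noteq> {}" and closed: "\<And>x y. x \<in> S \<Longrightarrow> y \<in> S \<Longrightarrow> mul x y \<in> S"
    and A: "A \<subseteq> S"
  shows "generated_subsemigroup T mul' (f ` A) = T \<longleftrightarrow> generated_subsemigroup S mul A = S"
proof -
  have T: "T = f ` S" and inj: "inj_on f S" using bij by (auto simp: bij_betw_def)
  have closed': "mul' x y \<in> T" if "x \<in> T" "y \<in> T" for x y
  proof -
    from that T obtain a b where "a \<in> S" "b \<in> S" "x = f a" "y = f b" by blast
    then show ?thesis using T closed hom by (metis imageI)
  qed
  have image_eq: "f ` U = T \<longleftrightarrow> U = S" if "U \<subseteq> S" for U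
    using inj_on_image_eq_iff[OF inj that subset_refl] T by simp
  have image_sub: "subsemigroup T mul' (f ` U)" if "subsemigroup S mul U" for U
    unfolding subsemigroup_def
  proof (intro conjI ballI)
    fix x y assume "x \<in> f ` U" "y \<in> f ` U"
    then obtain a b where "a \<in> U" "b \<in> U" "x = f a" "y = f b" by blast
    moreover from this that have "mul a b \<in> U" "a \<in> S" "b \<in> S"
      by (auto simp: subsemigroup_def)
    ultimately show "mul' x y \<in> f ` U" using hom by (metis imageI)
  qed (use that T in \<open>auto simp: subsemigroup_def\<close>)
  have preimage_sub: "subsemigroup S mul {x \<in> S. f x \<in> U}" if "subsemigroup T mul' U" for U
    using that closed hom T by (auto simp: subsemigroup_def)
  have "(\<forall>U. subsemigroup T mul' U \<and> f ` A \<subseteq> U \<longrightarrow> U = T)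
      \<longleftrightarrow> (\<forall>U. subsemigroup S mul U \<and> A \<subseteq> U \<longrightarrow> U = S)" (is "?T \<longleftrightarrow> ?S")
  proof
    assume ?T
    show ?S
    proof (intro allI impI)
      fix U assume U: "subsemigroup S mul U \<and> A \<subseteq> U"
      then have "f ` U = T" using \<open>?T\<close> image_sub[of U] by (auto intro: image_mono)
      then show "U = S" using image_eq U by (auto simp: subsemigroup_def)
    qed
  next
    assume ?S
    show ?T
    proof (intro allI impI)
      fix U assume U: "subsemigroup T mul' U \<and> f ` A \<subseteq> U"
      then have "{x \<in> S. f x \<in> U} = S"
        using \<open>?S\<close> preimage_sub[of U] A by blast
      then show "U = T" using U T by (auto simp: subsemigroup_def)
    qed
  qed
  moreover have "T \<noteq> {}" "f ` A \<subseteq> T" using ne T A by auto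
  ultimately show ?thesis
    using generated_subsemigroup_eq_iff[of T mul' "f ` A"] closed'
      generated_subsemigroup_eq_iff[of S mul A] ne closed A by blast
qed

lemma semigroup_rank_iso:
  assumes bij: "bij_betw f S T"
    and hom: "\<And>x y. x \<in> S \<Longrightarrow> y \<in> S \<Longrightarrow> f (mul x y) = mul' (f x) (f y)"
    and ne: "S \<noteq> {}" and closed: "\<And>x y. x \<in> S \<Longrightarrow> y \<in> S \<Longrightarrow> mul x y \<in> S"
  shows "semigroup_rank T mul' = semigroup_rank S mul"
proof -
  have T: "T = f ` S" and inj: "inj_on f S" using bij by (auto simp: bij_betw_def)
  have card: "card (f ` A) = card A" "finite (f ` A) \<longleftrightarrow> finite A" if "A \<subseteq> S" for A
    using inj_on_subset[OF inj that] by (auto simp: card_image finite_image_iff)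
  have gen: "generated_subsemigroup T mul' (f ` A) = T \<longleftrightarrow> generated_subsemigroup S mul A = S"
    if "A \<subseteq> S" for A
    using bij hom ne closed that by (rule generates_iso_image)
  have "(\<exists>B\<subseteq>T. B \<noteq> {} \<and> finite B \<and> card B = m \<and> generated_subsemigroup T mul' B = T)
      \<longleftrightarrow> (\<exists>A\<subseteq>S. A \<noteq> {} \<and> finite A \<and> card A = m \<and> generated_subsemigroup S mul A = S)"
    (is "?l \<longleftrightarrow> ?r") for m
  proof
    assume ?l
    then obtain B where B: "B \<subseteq> T" "B \<noteq> {}" "finite B" "card B = m"
      "generated_subsemigroup T mul' B = T" by blast
    obtain A where "A \<subseteq> S" "B = f ` A" using B(1) T by (auto simp: subset_image_iff)
    with B card gen show ?r by auto
  next
    assume ?r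
    then obtain A where A: "A \<subseteq> S" "A \<noteq> {}" "finite A" "card A = m"
      "generated_subsemigroup S mul A = S" by blast
    then have "f ` A \<subseteq> T" "f ` A \<noteq> {}" "finite (f ` A)" "card (f ` A) = m"
      "generated_subsemigroup T mul' (f ` A) = T" using card gen T by auto
    then show ?l by blast
  qed
  then show ?thesis by (simp add: semigroup_rank_def)
qed

section \<open>Growth of maps on intervals\<close>

lemma growth_lower:
  fixes f :: "nat \<Rightarrow> nat"
  assumes "a \<le> b" "\<And>x. a \<le> x \<Longrightarrow> x < b \<Longrightarrow> f x < f (Suc x)"
  shows "f a + (b - a) \<le> f b"
  using assms
proof (induction b rule: dec_induct)
  case (step k)
  then have "f a + (k - a) \<le> f k" "f k < f (Suc k)" by auto
  then show ?case using step.hyps by linarith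
qed simp

lemma growth_upper:
  fixes f :: "nat \<Rightarrow> nat"
  assumes "a \<le> b" "\<And>x. a \<le> x \<Longrightarrow> x < b \<Longrightarrow> f (Suc x) \<le> Suc (f x)"
  shows "f b \<le> f a + (b - a)"
  using assms
proof (induction b rule: dec_induct)
  case (step k)
  then have "f k \<le> f a + (k - a)" "f (Suc k) \<le> Suc (f k)" by auto
  then show ?case using step.hyps by linarith
qed simp

section \<open>The maps that omit the top element\<close>

lemma order_preserving_maps_ext:
  assumes "\<alpha> \<in> order_preserving_maps n" "\<beta> \<in> order_preserving_maps n"
    and "\<And>x. 1 \<le> x \<Longrightarrow> x \<le> n \<Longrightarrow> \<alpha> x = \<beta> x"
  shows "\<alpha> = \<beta>"
proof (rule PiE_ext)
  show "\<alpha> \<in> {1..n} \<rightarrow>\<^sub>E {1..n}" "\<beta> \<in> {1..n} \<rightarrow>\<^sub>E {1..n}"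
    using assms by (simp_all add: order_preserving_maps_def)
qed (use assms(3) in auto)

lemma map_mult_apply: "1 \<le> x \<Longrightarrow> x \<le> n \<Longrightarrow> map_mult n \<alpha> \<beta> x = \<beta> (\<alpha> x)"
  by (simp add: map_mult_def compose_def)

lemma order_preserving_mapsD:
  assumes "\<alpha> \<in> order_preserving_maps n"
  shows "1 \<le> x \<Longrightarrow> x \<le> n \<Longrightarrow> 1 \<le> \<alpha> x \<and> \<alpha> x \<le> n"
    and "1 \<le> x \<Longrightarrow> x \<le> y \<Longrightarrow> y \<le> n \<Longrightarrow> \<alpha> x \<le> \<alpha> y"
  using assms by (auto simp: order_preserving_maps_def PiE_iff mono_on_def)

lemma const_map_in: "k \<in> {1..n} \<Longrightarrow> const_map n k \<in> order_preserving_maps n"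
  by (auto simp: order_preserving_maps_def const_map_def mono_on_def)

text \<open>If \<open>n\<close> is a value of \<open>\<alpha>\<close>, then \<open>\<alpha>\<beta> = \<pi>\<^sub>1\<close> forces \<open>\<beta> n = 1\<close> and thus \<open>\<beta> = \<pi>\<^sub>1\<close>. Otherwise
  the map that sends \<open>n\<close> to itself and everything else to \<open>1\<close> is a witness.\<close>

lemma left_divisors_1_iff:
  assumes n: "n \<ge> 2"
  shows "\<alpha> \<in> left_divisors n 1 \<longleftrightarrow> \<alpha> \<in> order_preserving_maps n \<and> \<alpha> n < n"
proof (intro iffI conjI)
  assume \<alpha>: "\<alpha> \<in> left_divisors n 1"
  then show \<alpha>O: "\<alpha> \<in> order_preserving_maps n" by (simp add: left_divisors_def)
  from \<alpha> obtain \<beta> where \<beta>: "\<beta> \<in> order_preserving_maps n" "\<beta> \<noteq> const_map n 1"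
    and eq: "map_mult n \<alpha> \<beta> = const_map n 1" by (auto simp: left_divisors_def)
  have "\<beta> (\<alpha> n) = 1"
    using fun_cong[OF eq, of n] n by (simp add: map_mult_apply const_map_def)
  moreover have "\<alpha> n \<le> n" using order_preserving_mapsD(1)[OF \<alpha>O] n by simp
  moreover have "\<alpha> n \<noteq> n"
  proof
    assume "\<alpha> n = n"
    with calculation have "\<beta> n = 1" by simp
    have "\<beta> = const_map n 1"
    proof (rule order_preserving_maps_ext[OF \<beta>(1)])
      fix x assume "1 \<le> x" "x \<le> n"
      then show "\<beta> x = const_map n 1 x"
        using order_preserving_mapsD[OF \<beta>(1), of x] order_preserving_mapsD(2)[OF \<beta>(1), of x n]
          \<open>\<beta> n = 1\<close>
        by (simp add: const_map_def)
    qed (use n const_map_in in auto)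
    with \<beta>(2) show False ..
  qed
  ultimately show "\<alpha> n < n" by simp
next
  assume *: "\<alpha> \<in> order_preserving_maps n \<and> \<alpha> n < n"
  define \<beta> where "\<beta> = (\<lambda>x\<in>{1..n}. if x = n then n else 1)"
  have \<beta>: "\<beta> \<in> order_preserving_maps n"
    by (auto simp: order_preserving_maps_def \<beta>_def mono_on_def)
  have "\<beta> n \<noteq> const_map n 1 n" using n by (simp add: \<beta>_def const_map_def)
  then have "\<beta> \<noteq> const_map n 1" by auto
  moreover have "map_mult n \<alpha> \<beta> = const_map n 1"
  proof (rule order_preserving_maps_ext)
    fix x assume x: "1 \<le> x" "x \<le> n"
    then have "1 \<le> \<alpha> x" "\<alpha> x < n"
      using * order_preserving_mapsD(1)[of \<alpha> n x] order_preserving_mapsD(2)[of \<alpha> n x n] by auto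
    then show "map_mult n \<alpha> \<beta> x = const_map n 1 x"
      using x by (simp add: map_mult_apply \<beta>_def const_map_def)
  qed (use * \<beta> n map_mult_closed const_map_in in auto)
  ultimately show "\<alpha> \<in> left_divisors n 1" using * \<beta> by (auto simp: left_divisors_def)
qed

lemma left_divisors_1D:
  assumes "n \<ge> 2" "\<alpha> \<in> left_divisors n 1"
  shows "1 \<le> x \<Longrightarrow> x \<le> n \<Longrightarrow> 1 \<le> \<alpha> x \<and> \<alpha> x \<le> n - 1"
    and "1 \<le> x \<Longrightarrow> x \<le> y \<Longrightarrow> y \<le> n \<Longrightarrow> \<alpha> x \<le> \<alpha> y"
proof -
  have \<alpha>: "\<alpha> \<in> order_preserving_maps n" "\<alpha> n < n" using assms left_divisors_1_iff by auto
  show "1 \<le> x \<Longrightarrow> x \<le> n \<Longrightarrow> 1 \<le> \<alpha> x \<and> \<alpha> x \<le> n - 1"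
    using order_preserving_mapsD(1)[OF \<alpha>(1), of x] order_preserving_mapsD(2)[OF \<alpha>(1), of x n]
      \<alpha>(2) by auto
  show "1 \<le> x \<Longrightarrow> x \<le> y \<Longrightarrow> y \<le> n \<Longrightarrow> \<alpha> x \<le> \<alpha> y"
    by (rule order_preserving_mapsD(2)[OF \<alpha>(1)])
qed

lemma left_divisors_1_ext:
  assumes "\<alpha> \<in> left_divisors n 1" "\<beta> \<in> left_divisors n 1"
    and "\<And>x. 1 \<le> x \<Longrightarrow> x \<le> n \<Longrightarrow> \<alpha> x = \<beta> x"
  shows "\<alpha> = \<beta>"
  using assms order_preserving_maps_ext[of \<alpha> n \<beta>] by (simp add: left_divisors_def)

lemma restrict_in_left_divisors_1:
  assumes "n \<ge> 2"
    and "\<And>x. 1 \<le> x \<Longrightarrow> x \<le> n \<Longrightarrow> 1 \<le> f x \<and> f x \<le> n - 1"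
    and "\<And>x y. 1 \<le> x \<Longrightarrow> x \<le> y \<Longrightarrow> y \<le> n \<Longrightarrow> f x \<le> f y"
  shows "restrict f {1..n} \<in> left_divisors n 1"
proof -
  have "restrict f {1..n} \<in> order_preserving_maps n"
    using assms(2,3) by (force simp: order_preserving_maps_def mono_on_def)
  moreover have "restrict f {1..n} n < n" using assms(1) assms(2)[of n] by auto
  ultimately show ?thesis using left_divisors_1_iff[OF assms(1)] by blast
qed

lemma left_divisors_1_closed:
  "n \<ge> 2 \<Longrightarrow> \<alpha> \<in> left_divisors n 1 \<Longrightarrow> \<gamma> \<in> left_divisors n 1 \<Longrightarrow>
    map_mult n \<alpha> \<gamma> \<in> left_divisors n 1"
  using left_divisors_mult_closed[of 1 n] by simp

lemma left_divisors_1_nonempty: "n \<ge> 2 \<Longrightarrow> left_divisors n 1 \<noteq> {}"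
  using left_divisors_subsemigroup[of 1 n] by (auto simp: subsemigroup_def)

lemma generates_left_divisors_1_iff:
  assumes "n \<ge> 2" "A \<subseteq> left_divisors n 1"
  shows "generated_subsemigroup (left_divisors n 1) (map_mult n) A = left_divisors n 1 \<longleftrightarrow>
    (\<forall>U. subsemigroup (left_divisors n 1) (map_mult n) U \<and> A \<subseteq> U \<longrightarrow> U = left_divisors n 1)"
  by (intro generated_subsemigroup_eq_iff left_divisors_1_nonempty left_divisors_1_closed assms)

definition merge :: "nat \<Rightarrow> nat \<Rightarrow> nat \<Rightarrow> nat" where
  "merge n i = (\<lambda>x\<in>{1..n}. if x \<le> i then x else x - 1)"

text \<open>As a right factor the map acts on \<open>{1..n-1}\<close>, where it moves only \<open>j\<close>. Capping the value at
  \<open>n\<close> keeps it inside the semigroup.\<close>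

definition bump :: "nat \<Rightarrow> nat \<Rightarrow> nat \<Rightarrow> nat" where
  "bump n j = (\<lambda>x\<in>{1..n}. if x = j then j + 1 else min x (n - 1))"

lemma merge_in: "n \<ge> 2 \<Longrightarrow> i \<in> {1..n-1} \<Longrightarrow> merge n i \<in> left_divisors n 1"
  unfolding merge_def by (rule restrict_in_left_divisors_1) (auto split: if_splits)

lemma bump_in: "n \<ge> 2 \<Longrightarrow> j \<in> {1..n-2} \<Longrightarrow> bump n j \<in> left_divisors n 1"
  unfolding bump_def by (rule restrict_in_left_divisors_1) (auto split: if_splits)

section \<open>Unavoidable generators\<close>

text \<open>A map that rises strictly everywhere except possibly from \<open>i\<close> to \<open>i + 1\<close> has no room
  left between \<open>1\<close> and \<open>n - 1\<close>.\<close>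

lemma eq_merge_if_strict_off_one_step:
  assumes n: "n \<ge> 2" and i: "i \<in> {1..n-1}" and \<alpha>: "\<alpha> \<in> left_divisors n 1"
    and strict: "\<And>x. 1 \<le> x \<Longrightarrow> x < n \<Longrightarrow> x \<noteq> i \<Longrightarrow> \<alpha> x < \<alpha> (Suc x)"
  shows "\<alpha> = merge n i"
proof (rule left_divisors_1_ext[OF \<alpha> merge_in[OF n i]])
  fix x assume x: "1 \<le> x" "x \<le> n"
  have i': "Suc i \<le> n" using i n by auto
  have step: "\<alpha> i \<le> \<alpha> (Suc i)" using left_divisors_1D(2)[OF n \<alpha>, of i "Suc i"] i by auto
  have first: "1 \<le> \<alpha> 1" and last: "\<alpha> n \<le> n - 1"
    using left_divisors_1D(1)[OF n \<alpha>, of 1] left_divisors_1D(1)[OF n \<alpha>, of n] n by auto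
  have low: "\<alpha> a + (b - a) \<le> \<alpha> b" if "1 \<le> a" "a \<le> b" "b \<le> i" for a b
    using that strict i by (intro growth_lower) auto
  have high: "\<alpha> a + (b - a) \<le> \<alpha> b" if "Suc i \<le> a" "a \<le> b" "b \<le> n" for a b
    using that strict i by (intro growth_lower) auto
  have "\<alpha> x = x" if "x \<le> i"
    using low[of 1 x] low[of x i] high[of "Suc i" n] step first last that x i i' by auto
  moreover have "\<alpha> x = x - 1" if "\<not> x \<le> i"
    using low[of 1 i] high[of "Suc i" x] high[of x n] step first last that x i i' by auto
  ultimately show "\<alpha> x = merge n i x" using x by (simp add: merge_def)
qed

text \<open>Points that \<open>merge n i\<close> separates must already be separated by \<open>\<alpha>\<close>.\<close>

lemma merge_left_factor:
  assumes n: "n \<ge> 2" and i: "i \<in> {1..n-1}" and \<alpha>: "\<alpha> \<in> left_divisors n 1"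
    and eq: "map_mult n \<alpha> \<gamma> = merge n i"
  shows "\<alpha> = merge n i"
proof (rule eq_merge_if_strict_off_one_step[OF n i \<alpha>])
  fix x assume x: "1 \<le> x" "x < n" "x \<noteq> i"
  have "\<gamma> (\<alpha> x) = merge n i x" "\<gamma> (\<alpha> (Suc x)) = merge n i (Suc x)"
    using x fun_cong[OF eq, of x] fun_cong[OF eq, of "Suc x"] by (simp_all add: map_mult_apply)
  moreover have "merge n i x \<noteq> merge n i (Suc x)" using x by (auto simp: merge_def)
  ultimately have "\<alpha> x \<noteq> \<alpha> (Suc x)" by auto
  then show "\<alpha> x < \<alpha> (Suc x)" using left_divisors_1D(2)[OF n \<alpha>, of x "Suc x"] x by simp
qed

text \<open>The image of a product lies in the image of its right factor. So if \<open>\<gamma>\<close> does not have the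
  required image itself, it takes the value \<open>j\<close> as well, and then it is the identity on
  \<open>{1..n-1}\<close>, so that the image of the product is that of \<open>\<alpha>\<close>.\<close>

lemma image_omitting_one_point_factor:
  assumes n: "n \<ge> 2" and j: "j \<in> {1..n-2}"
    and \<alpha>: "\<alpha> \<in> left_divisors n 1" and \<gamma>: "\<gamma> \<in> left_divisors n 1"
    and img: "map_mult n \<alpha> \<gamma> ` {1..n} = {1..n-1} - {j}"
  shows "\<alpha> ` {1..n} = {1..n-1} - {j} \<or> \<gamma> ` {1..n} = {1..n-1} - {j}"
proof (rule disjCI)
  assume neq: "\<gamma> ` {1..n} \<noteq> {1..n-1} - {j}"
  have \<alpha>_img: "\<alpha> ` {1..n} \<subseteq> {1..n-1}" using left_divisors_1D(1)[OF n \<alpha>] by force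
  have \<gamma>_img: "\<gamma> ` {1..n} \<subseteq> {1..n-1}" using left_divisors_1D(1)[OF n \<gamma>] by force
  have prod: "map_mult n \<alpha> \<gamma> ` {1..n} = \<gamma> ` \<alpha> ` {1..n}"
    by (auto simp: map_mult_apply image_image intro!: image_cong)
  have sub: "{1..n-1} - {j} \<subseteq> \<gamma> ` {1..n-1}"
    using image_mono[OF \<alpha>_img, of \<gamma>] img prod by simp
  have "\<gamma> ` {1..n-1} \<subseteq> \<gamma> ` {1..n}" by (rule image_mono) auto
  with sub neq \<gamma>_img have "j \<in> \<gamma> ` {1..n}" by blast
  then obtain k where k: "1 \<le> k" "k \<le> n" "\<gamma> k = j" by auto
  \<comment> \<open>As \<open>j < n - 1\<close>, the value \<open>n - 1\<close> is attained below \<open>n\<close>; hence \<open>\<gamma> n = n - 1\<close> is not \<open>j\<close>.\<close>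
  have "n - 1 \<in> \<gamma> ` {1..n-1}" using sub j by auto
  then obtain l where l: "1 \<le> l" "l \<le> n - 1" "\<gamma> l = n - 1" by auto
  then have "n - 1 \<le> \<gamma> n" using left_divisors_1D(2)[OF n \<gamma>, of l n] by auto
  with k j have "k \<noteq> n" by auto
  with k have "j \<in> \<gamma> ` {1..n-1}" by auto
  with sub have "{1..n-1} \<subseteq> \<gamma> ` {1..n-1}" by blast
  then have inj: "inj_on \<gamma> {1..n-1}"
    by (intro finite_surj_inj) simp_all
  have strict: "\<gamma> x < \<gamma> (Suc x)" if "1 \<le> x" "x < n - 1" for x
  proof -
    have "\<gamma> x \<noteq> \<gamma> (Suc x)" using that inj_onD[OF inj, of x "Suc x"] by auto
    moreover have "\<gamma> x \<le> \<gamma> (Suc x)" using that by (intro left_divisors_1D(2)[OF n \<gamma>]) auto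
    ultimately show ?thesis by simp
  qed
  have "\<gamma> y = y" if y: "1 \<le> y" "y \<le> n - 1" for y
  proof -
    have "\<gamma> 1 + (y - 1) \<le> \<gamma> y" "\<gamma> y + (n - 1 - y) \<le> \<gamma> (n - 1)"
      using y strict by (intro growth_lower; simp)+
    moreover have "1 \<le> \<gamma> 1" "\<gamma> (n - 1) \<le> n - 1"
      using left_divisors_1D(1)[OF n \<gamma>, of 1] left_divisors_1D(1)[OF n \<gamma>, of "n - 1"] n by auto
    ultimately show ?thesis using y by linarith
  qed
  then have "\<gamma> y = y" if "y \<in> \<alpha> ` {1..n}" for y
    using subsetD[OF \<alpha>_img that] by simp
  then have "\<gamma> ` \<alpha> ` {1..n} = \<alpha> ` {1..n}" by (metis image_cong image_ident)
  with img prod show "\<alpha> ` {1..n} = {1..n-1} - {j}" by simp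
qed

lemma merge_image:
  assumes "n \<ge> 2" "i \<in> {1..n-1}"
  shows "merge n i ` {1..n} = {1..n-1}"
proof
  show "merge n i ` {1..n} \<subseteq> {1..n-1}" using left_divisors_1D(1)[OF assms(1) merge_in[OF assms]] by force
  show "{1..n-1} \<subseteq> merge n i ` {1..n}"
  proof
    fix y assume y: "y \<in> {1..n-1}"
    show "y \<in> merge n i ` {1..n}"
    proof (cases "y \<le> i")
      case True
      then show ?thesis using y by (intro image_eqI[of _ _ y]) (auto simp: merge_def)
    next
      case False
      then show ?thesis using y by (intro image_eqI[of _ _ "Suc y"]) (auto simp: merge_def)
    qed
  qed
qed

lemma inj_on_merge: "inj_on (merge n) {1..n-1}"
proof (rule inj_onI, rule ccontr)
  fix i k assume ik: "i \<in> {1..n-1}" "k \<in> {1..n-1}" "merge n i = merge n k" "i \<noteq> k"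
  have "merge n i (Suc (min i k)) = merge n k (Suc (min i k))" using ik by simp
  then show False using ik by (auto simp: merge_def min_def split: if_splits)
qed

text \<open>A generating set lies in no proper subsemigroup. By \<open>merge_left_factor\<close> and
  \<open>image_omitting_one_point_factor\<close>, both the complement of one \<open>merge n i\<close> and the set of maps
  whose image is not \<open>{1..n-1} - {j}\<close> are proper subsemigroups. The generators found in this way are told apart by their images.\<close>

lemma generating_set_card:
  assumes n: "n \<ge> 3" and A: "A \<subseteq> left_divisors n 1" "finite A"
    and gen: "generated_subsemigroup (left_divisors n 1) (map_mult n) A = left_divisors n 1"
  shows "2 * n - 3 \<le> card A"
proof -
  let ?S = "left_divisors n 1" and ?E = "merge n ` {1..n-1}"
  let ?W = "\<lambda>j. {1..n-1} - {j}"
  have n2: "n \<ge> 2" using n by simp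
  have gen': "U = ?S" if "subsemigroup ?S (map_mult n) U" "A \<subseteq> U" for U
    using gen that generates_left_divisors_1_iff[OF n2 A(1)] by simp
  have E: "?E \<subseteq> A"
  proof (rule image_subsetI, rule ccontr)
    fix i assume i: "i \<in> {1..n-1}" and notin: "merge n i \<notin> A"
    \<comment> \<open>Any other merge shows that the complement of \<open>merge n i\<close> is nonempty.\<close>
    define k where "k = (if i = 1 then 2 else 1::nat)"
    have k: "k \<in> {1..n-1}" "k \<noteq> i" using n by (auto simp: k_def)
    then have "merge n k \<in> ?S - {merge n i}"
      using merge_in[OF n2 k(1)] inj_on_eq_iff[OF inj_on_merge k(1) i] by simp
    then have "subsemigroup ?S (map_mult n) (?S - {merge n i})"
      using left_divisors_1_closed[OF n2] merge_left_factor[OF n2 i]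
      by (auto simp: subsemigroup_def)
    then have "?S - {merge n i} = ?S" using gen' A(1) notin by blast
    then show False using merge_in[OF n2 i] by blast
  qed
  have W: "?W j \<in> (\<lambda>\<alpha>. \<alpha> ` {1..n}) ` (A - ?E)" if j: "j \<in> {1..n-2}" for j
  proof -
    have full: "\<alpha> ` {1..n} \<noteq> ?W j" if "\<alpha> \<in> ?E" for \<alpha>
      using that merge_image[OF n2] j by force
    have "\<exists>\<alpha>\<in>A. \<alpha> ` {1..n} = ?W j"
    proof (rule ccontr)
      assume none: "\<not> (\<exists>\<alpha>\<in>A. \<alpha> ` {1..n} = ?W j)"
      define U where "U = {\<alpha> \<in> ?S. \<alpha> ` {1..n} \<noteq> ?W j}"
      have U: "\<alpha> \<in> U \<longleftrightarrow> \<alpha> \<in> ?S \<and> \<alpha> ` {1..n} \<noteq> ?W j" for \<alpha>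
        unfolding U_def by (rule mem_Collect_eq)
      have "merge n 1 \<in> U"
        unfolding U using full[of "merge n 1"] merge_in[OF n2, of 1] n by auto
      moreover have "map_mult n \<alpha> \<gamma> \<in> U" if "\<alpha> \<in> U" "\<gamma> \<in> U" for \<alpha> \<gamma>
        using that left_divisors_1_closed[OF n2] image_omitting_one_point_factor[OF n2 j]
        unfolding U by metis
      moreover have "U \<subseteq> ?S" using U by blast
      ultimately have "subsemigroup ?S (map_mult n) U"
        unfolding subsemigroup_def by blast
      moreover have "A \<subseteq> U"
      proof
        fix \<alpha> assume "\<alpha> \<in> A"
        then show "\<alpha> \<in> U" unfolding U using none A(1) by (meson subsetD)
      qed
      ultimately have "U = ?S" by (rule gen')
      moreover have "bump n j \<in> ?S" using bump_in[OF n2 j] .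
      moreover have "bump n j ` {1..n} = ?W j"
      proof
        show "bump n j ` {1..n} \<subseteq> ?W j" using j by (auto simp: bump_def min_def)
        show "?W j \<subseteq> bump n j ` {1..n}"
        proof
          fix y assume "y \<in> ?W j"
          then show "y \<in> bump n j ` {1..n}"
            by (intro image_eqI[of _ _ y]) (auto simp: bump_def)
        qed
      qed
      ultimately show False using U by metis
    qed
    then obtain \<alpha> where \<alpha>: "\<alpha> \<in> A" "\<alpha> ` {1..n} = ?W j" ..
    with full have "\<alpha> \<in> A - ?E" by (metis DiffI)
    with \<alpha>(2) show ?thesis by (metis image_eqI)
  qed
  have "inj_on ?W {1..n-2}" by (rule inj_onI) force
  then have "n - 2 = card (?W ` {1..n-2})" by (simp add: card_image)
  also have "\<dots> \<le> card ((\<lambda>\<alpha>. \<alpha> ` {1..n}) ` (A - ?E))"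
    using W A(2) by (intro card_mono) auto
  also have "\<dots> \<le> card (A - ?E)" using A(2) by (intro card_image_le) auto
  finally have "n - 2 \<le> card (A - ?E)" .
  moreover have "card ?E = n - 1" by (simp add: card_image[OF inj_on_merge] del: One_nat_def)
  moreover have "card A = card ?E + card (A - ?E)"
    using E A(2) card_Diff_subset[of ?E A] card_mono[of A ?E] by simp
  ultimately show ?thesis by linarith
qed

section \<open>A generating set of the smallest size\<close>

text \<open>Splitting a kernel class of the map in two raises \<open>\<alpha> n\<close> by one, and a merge undoes the
  splitting. When \<open>\<alpha> n\<close> has reached \<open>n - 1\<close>, the map is itself a merge.\<close>

lemma generate_initial_segment:
  assumes n: "n \<ge> 2" and U: "subsemigroup (left_divisors n 1) (map_mult n) U"
    and E: "merge n ` {1..n-1} \<subseteq> U"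
    and \<alpha>: "\<alpha> \<in> left_divisors n 1" and first: "\<alpha> 1 = 1"
    and steps: "\<And>x. 1 \<le> x \<Longrightarrow> x < n \<Longrightarrow> \<alpha> (Suc x) \<le> Suc (\<alpha> x)"
  shows "\<alpha> \<in> U"
  using \<alpha> first steps
proof (induction "n - \<alpha> n" arbitrary: \<alpha> rule: less_induct)
  case less
  note \<alpha> = less.prems(1) and first = less.prems(2) and steps = less.prems(3)
  note range = left_divisors_1D(1)[OF n \<alpha>] and mono = left_divisors_1D(2)[OF n \<alpha>]
  have "\<exists>a. 1 \<le> a \<and> a < n \<and> \<alpha> (Suc a) = \<alpha> a"
  proof (rule ccontr)
    assume "\<not> ?thesis"
    then have "\<alpha> x < \<alpha> (Suc x)" if "1 \<le> x" "x < n" for x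
      using mono[of x "Suc x"] that by (metis Suc_leI le_SucI le_neq_implies_less order_refl)
    then have "\<alpha> 1 + (n - 1) \<le> \<alpha> n" using n by (intro growth_lower) auto
    then show False using first range[of n] n by auto
  qed
  then obtain a where a: "1 \<le> a" "a < n" "\<alpha> (Suc a) = \<alpha> a" by blast
  show ?case
  proof (cases "\<alpha> n = n - 1")
    case True
    have up: "\<alpha> y \<le> \<alpha> x + (y - x)" if "1 \<le> x" "x \<le> y" "y \<le> n" for x y
      using that steps by (intro growth_upper) auto
    have "\<alpha> = merge n a"
    proof (rule left_divisors_1_ext[OF \<alpha> merge_in[OF n]])
      fix x assume x: "1 \<le> x" "x \<le> n"
      have "\<alpha> x = x" if "x \<le> a"
        using up[of 1 x] up[of x a] up[of "Suc a" n] first a True that x by auto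
      moreover have "\<alpha> x = x - 1" if "\<not> x \<le> a"
        using up[of 1 a] up[of "Suc a" x] up[of x n] first a True that x by auto
      ultimately show "\<alpha> x = merge n a x" using x by (simp add: merge_def)
    qed (use a in auto)
    then show ?thesis using E a by auto
  next
    case False
    then have small: "\<alpha> n < n - 1" using range[of n] n by auto
    have v: "\<alpha> a \<in> {1..n-1}" using range[of a] a by auto
    define \<beta> where "\<beta> = (\<lambda>x\<in>{1..n}. if x \<le> a then \<alpha> x else Suc (\<alpha> x))"
    have \<beta>: "\<beta> \<in> left_divisors n 1"
      unfolding \<beta>_def
    proof (rule restrict_in_left_divisors_1[OF n])
      fix x assume "1 \<le> x" "x \<le> n"
      then show "1 \<le> (if x \<le> a then \<alpha> x else Suc (\<alpha> x)) \<and>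
          (if x \<le> a then \<alpha> x else Suc (\<alpha> x)) \<le> n - 1"
        using range[of x] mono[of x n] small by auto
    next
      fix x y assume "1 \<le> x" "x \<le> y" "y \<le> n"
      then show "(if x \<le> a then \<alpha> x else Suc (\<alpha> x)) \<le> (if y \<le> a then \<alpha> y else Suc (\<alpha> y))"
        using mono[of x y] by auto
    qed
    have "\<beta> \<in> U"
    proof (rule less.hyps[OF _ \<beta>])
      show "n - \<beta> n < n - \<alpha> n" using a n small by (auto simp: \<beta>_def)
      show "\<beta> 1 = 1" using first a n by (simp add: \<beta>_def)
      fix x assume "1 \<le> x" "x < n"
      then show "\<beta> (Suc x) \<le> Suc (\<beta> x)" using steps[of x] a
        by (cases "x = a") (auto simp: \<beta>_def)
    qed
    moreover have "merge n (\<alpha> a) \<in> U" using E v by blast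
    moreover have "\<alpha> = map_mult n \<beta> (merge n (\<alpha> a))"
    proof (rule left_divisors_1_ext[OF \<alpha> left_divisors_1_closed[OF n \<beta> merge_in[OF n v]]])
      fix x assume x: "1 \<le> x" "x \<le> n"
      have "\<beta> x \<in> {1..n}" using left_divisors_1D(1)[OF n \<beta> x] by auto
      moreover have "\<alpha> x \<le> \<alpha> a" if "x \<le> a" using mono[of x a] x a that by auto
      moreover have "\<alpha> a \<le> \<alpha> x" if "\<not> x \<le> a" using mono[of a x] x a that by auto
      ultimately show "\<alpha> x = map_mult n \<beta> (merge n (\<alpha> a)) x"
        using x by (auto simp: map_mult_apply merge_def \<beta>_def)
    qed
    ultimately show ?thesis using U unfolding subsemigroup_def by metis
  qed
qed

text \<open>Lowering a value \<open>v + 1\<close> above an omitted \<open>v\<close> decreases the sum of the values. If there is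
  no such \<open>v\<close>, the image is an initial segment.\<close>

lemma generate_all:
  assumes n: "n \<ge> 2" and U: "subsemigroup (left_divisors n 1) (map_mult n) U"
    and E: "merge n ` {1..n-1} \<subseteq> U" and D: "bump n ` {1..n-2} \<subseteq> U"
    and \<alpha>: "\<alpha> \<in> left_divisors n 1"
  shows "\<alpha> \<in> U"
  using \<alpha>
proof (induction "\<Sum>x\<in>{1..n}. \<alpha> x" arbitrary: \<alpha> rule: less_induct)
  case less
  note \<alpha> = less.prems
  note range = left_divisors_1D(1)[OF n \<alpha>] and mono = left_divisors_1D(2)[OF n \<alpha>]
  show ?case
  proof (cases "\<exists>v\<ge>1. Suc v \<in> \<alpha> ` {1..n} \<and> v \<notin> \<alpha> ` {1..n}")
    case True
    then obtain v z where v: "1 \<le> v" "v \<notin> \<alpha> ` {1..n}" and z: "1 \<le> z" "z \<le> n" "\<alpha> z = Suc v"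
      by auto
    have vn: "v \<in> {1..n-2}" using range[of z] z v by auto
    define \<beta> where "\<beta> = (\<lambda>x\<in>{1..n}. if \<alpha> x = Suc v then v else \<alpha> x)"
    have \<beta>: "\<beta> \<in> left_divisors n 1"
      unfolding \<beta>_def
    proof (rule restrict_in_left_divisors_1[OF n])
      fix x assume "1 \<le> x" "x \<le> n"
      then show "1 \<le> (if \<alpha> x = Suc v then v else \<alpha> x) \<and>
          (if \<alpha> x = Suc v then v else \<alpha> x) \<le> n - 1"
        using range[of x] v by auto
    next
      fix x y assume xy: "1 \<le> x" "x \<le> y" "y \<le> n"
      then have "\<alpha> x \<noteq> v" using v(2) by auto
      then show "(if \<alpha> x = Suc v then v else \<alpha> x) \<le> (if \<alpha> y = Suc v then v else \<alpha> y)"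
        using mono[of x y] xy by auto
    qed
    have "(\<Sum>x\<in>{1..n}. \<beta> x) < (\<Sum>x\<in>{1..n}. \<alpha> x)"
      by (rule sum_strict_mono_ex1) (use z in \<open>auto simp: \<beta>_def\<close>)
    then have "\<beta> \<in> U" using less.hyps \<beta> by blast
    moreover have "bump n v \<in> U" using D vn by blast
    moreover have "\<alpha> = map_mult n \<beta> (bump n v)"
    proof (rule left_divisors_1_ext[OF \<alpha> left_divisors_1_closed[OF n \<beta> bump_in[OF n vn]]])
      fix x assume x: "1 \<le> x" "x \<le> n"
      then have "\<alpha> x \<noteq> v" using v(2) by auto
      then show "\<alpha> x = map_mult n \<beta> (bump n v) x"
        using x range[OF x] vn by (auto simp: map_mult_apply bump_def \<beta>_def)
    qed
    ultimately show ?thesis using U unfolding subsemigroup_def by metis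
  next
    case False
    show ?thesis
    proof (rule generate_initial_segment[OF n U E \<alpha>])
      show "\<alpha> 1 = 1"
      proof (rule ccontr)
        assume "\<alpha> 1 \<noteq> 1"
        then have *: "1 < \<alpha> 1" using range[of 1] n by auto
        have "\<alpha> 1 - 1 \<notin> \<alpha> ` {1..n}" using mono[of 1] * by force
        moreover have "Suc (\<alpha> 1 - 1) \<in> \<alpha> ` {1..n}" using * n by auto
        moreover have "\<alpha> 1 - 1 \<ge> 1" using * by auto
        ultimately show False using False by blast
      qed
    next
      fix x assume x: "1 \<le> x" "x < n"
      show "\<alpha> (Suc x) \<le> Suc (\<alpha> x)"
      proof (rule ccontr)
        assume *: "\<not> \<alpha> (Suc x) \<le> Suc (\<alpha> x)"
        have "\<alpha> (Suc x) - 1 \<noteq> \<alpha> y" if y: "1 \<le> y" "y \<le> n" for y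
          using mono[of y x] mono[of "Suc x" y] x y * by (cases "y \<le> x") auto
        then have "\<alpha> (Suc x) - 1 \<notin> \<alpha> ` {1..n}" unfolding image_iff by auto
        moreover have "Suc (\<alpha> (Suc x) - 1) \<in> \<alpha> ` {1..n}" using * x by auto
        moreover have "\<alpha> (Suc x) - 1 \<ge> 1" using * by auto
        ultimately show False using False by blast
      qed
    qed
  qed
qed

lemma semigroup_rank_left_divisors_1:
  assumes n: "n \<ge> 3"
  shows "semigroup_rank (left_divisors n 1) (map_mult n) = 2 * n - 3"
proof -
  let ?S = "left_divisors n 1"
  let ?A = "merge n ` {1..n-1} \<union> bump n ` {1..n-2}"
  have n2: "n \<ge> 2" using n by simp
  have A: "?A \<subseteq> ?S" "finite ?A" "?A \<noteq> {}" using merge_in[OF n2] bump_in[OF n2] n by auto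
  have gen: "generated_subsemigroup ?S (map_mult n) ?A = ?S"
    unfolding generates_left_divisors_1_iff[OF n2 A(1)]
  proof (intro allI impI)
    fix U assume U: "subsemigroup ?S (map_mult n) U \<and> ?A \<subseteq> U"
    then have "?S \<subseteq> U" using generate_all[OF n2, of U] by blast
    with U show "U = ?S" by (auto simp: subsemigroup_def)
  qed
  have "card ?A \<le> card (merge n ` {1..n-1}) + card (bump n ` {1..n-2})" by (rule card_Un_le)
  also have "\<dots> \<le> (n - 1) + (n - 2)"
    using card_image_le[of "{1..n-1}" "merge n"] card_image_le[of "{1..n-2}" "bump n"]
    by (intro add_mono) simp_all
  finally have "card ?A \<le> 2 * n - 3" using n by simp
  then have "card ?A = 2 * n - 3" using generating_set_card[OF n A(1,2) gen] by simp
  then have "\<exists>B\<subseteq>?S. B \<noteq> {} \<and> finite B \<and> card B = 2 * n - 3 \<and>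
      generated_subsemigroup ?S (map_mult n) B = ?S"
    using A gen by (intro exI[of _ ?A] conjI)
  then show ?thesis
    unfolding semigroup_rank_def
  proof (rule Least_equality)
    fix m assume "\<exists>B\<subseteq>?S. B \<noteq> {} \<and> finite B \<and> card B = m \<and>
      generated_subsemigroup ?S (map_mult n) B = ?S"
    then show "2 * n - 3 \<le> m" using generating_set_card[OF n] by auto
  qed
qed

section \<open>Reversing the chain\<close>

definition reverse_conj :: "nat \<Rightarrow> (nat \<Rightarrow> nat) \<Rightarrow> nat \<Rightarrow> nat" where
  "reverse_conj n \<alpha> = (\<lambda>x\<in>{1..n}. Suc n - \<alpha> (Suc n - x))"

lemma reverse_conj_in:
  assumes "\<alpha> \<in> order_preserving_maps n"
  shows "reverse_conj n \<alpha> \<in> order_preserving_maps n"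
proof -
  have "Suc n - \<alpha> (Suc n - x) \<in> {1..n}" if "x \<in> {1..n}" for x
  proof -
    have "1 \<le> \<alpha> (Suc n - x) \<and> \<alpha> (Suc n - x) \<le> n"
      using that by (intro order_preserving_mapsD(1)[OF assms]) auto
    then show ?thesis by auto
  qed
  moreover have "Suc n - \<alpha> (Suc n - x) \<le> Suc n - \<alpha> (Suc n - y)"
    if "x \<in> {1..n}" "y \<in> {1..n}" "x \<le> y" for x y
    using order_preserving_mapsD(2)[OF assms, of "Suc n - y" "Suc n - x"] that
    by (intro diff_le_mono2) auto
  ultimately show ?thesis
    unfolding order_preserving_maps_def reverse_conj_def mono_on_def PiE_iff
    by (simp del: atLeastAtMost_iff One_nat_def)
qed

lemma reverse_conj_involution:
  assumes "\<alpha> \<in> order_preserving_maps n"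
  shows "reverse_conj n (reverse_conj n \<alpha>) = \<alpha>"
proof (rule order_preserving_maps_ext)
  fix x assume "1 \<le> x" "x \<le> n"
  then show "reverse_conj n (reverse_conj n \<alpha>) x = \<alpha> x"
    using order_preserving_mapsD(1)[OF assms, of x] by (auto simp: reverse_conj_def)
qed (use assms reverse_conj_in in auto)

lemma reverse_conj_mult:
  assumes "\<alpha> \<in> order_preserving_maps n" "\<beta> \<in> order_preserving_maps n"
  shows "reverse_conj n (map_mult n \<alpha> \<beta>) = map_mult n (reverse_conj n \<alpha>) (reverse_conj n \<beta>)"
proof (rule order_preserving_maps_ext)
  fix x assume x: "1 \<le> x" "x \<le> n"
  have "1 \<le> \<alpha> (Suc n - x) \<and> \<alpha> (Suc n - x) \<le> n"
    using order_preserving_mapsD(1)[OF assms(1), of "Suc n - x"] x by auto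
  then show "reverse_conj n (map_mult n \<alpha> \<beta>) x =
      map_mult n (reverse_conj n \<alpha>) (reverse_conj n \<beta>) x"
    using x by (auto simp: reverse_conj_def map_mult_apply)
qed (use assms reverse_conj_in map_mult_closed in auto)

lemma reverse_conj_const: "reverse_conj n (const_map n k) = const_map n (Suc n - k)"
  by (auto simp: reverse_conj_def const_map_def fun_eq_iff)

lemma reverse_conj_left_divisors:
  assumes k: "k \<in> {1..n}" and \<alpha>: "\<alpha> \<in> left_divisors n k"
  shows "reverse_conj n \<alpha> \<in> left_divisors n (Suc n - k)"
proof -
  from \<alpha> obtain \<beta> where \<beta>: "\<beta> \<in> order_preserving_maps n" "\<beta> \<noteq> const_map n k"
    and eq: "map_mult n \<alpha> \<beta> = const_map n k" by (auto simp: left_divisors_def)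
  have \<alpha>O: "\<alpha> \<in> order_preserving_maps n" using \<alpha> by (simp add: left_divisors_def)
  have "reverse_conj n \<beta> \<noteq> const_map n (Suc n - k)"
    using \<beta> reverse_conj_involution[OF \<beta>(1)] reverse_conj_involution[OF const_map_in[OF k]]
    by (metis reverse_conj_const)
  moreover have "map_mult n (reverse_conj n \<alpha>) (reverse_conj n \<beta>) = const_map n (Suc n - k)"
    using reverse_conj_mult[OF \<alpha>O \<beta>(1)] eq reverse_conj_const by simp
  ultimately show ?thesis
    using reverse_conj_in[OF \<alpha>O] reverse_conj_in[OF \<beta>(1)] by (auto simp: left_divisors_def)
qed

lemma semigroup_rank_left_divisors_reverse:
  assumes k: "k \<in> {1..n}" and n: "n \<ge> 2"
  shows "semigroup_rank (left_divisors n (Suc n - k)) (map_mult n) =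
    semigroup_rank (left_divisors n k) (map_mult n)"
proof (rule semigroup_rank_iso[where f = "reverse_conj n"])
  have inv: "reverse_conj n (reverse_conj n \<alpha>) = \<alpha>" if "\<alpha> \<in> left_divisors n l" for \<alpha> l
    using that reverse_conj_involution by (simp add: left_divisors_def)
  have "reverse_conj n ` left_divisors n (Suc n - k) \<subseteq> left_divisors n k"
  proof (rule image_subsetI)
    fix \<alpha> assume "\<alpha> \<in> left_divisors n (Suc n - k)"
    then have "reverse_conj n \<alpha> \<in> left_divisors n (Suc n - (Suc n - k))"
      using k by (intro reverse_conj_left_divisors) auto
    moreover have "Suc n - (Suc n - k) = k" using k by auto
    ultimately show "reverse_conj n \<alpha> \<in> left_divisors n k" by simp
  qed
  then show "bij_betw (reverse_conj n) (left_divisors n k) (left_divisors n (Suc n - k))"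
    using reverse_conj_left_divisors[OF k] k inv
    by (intro bij_betw_byWitness[where f' = "reverse_conj n"]) auto
  show "left_divisors n k \<noteq> {}"
    using left_divisors_subsemigroup[OF k n] by (simp add: subsemigroup_def)
  fix \<alpha> \<gamma> assume in_L: "\<alpha> \<in> left_divisors n k" "\<gamma> \<in> left_divisors n k"
  then show "map_mult n \<alpha> \<gamma> \<in> left_divisors n k" by (rule left_divisors_mult_closed[OF k])
  from in_L show "reverse_conj n (map_mult n \<alpha> \<gamma>) =
      map_mult n (reverse_conj n \<alpha>) (reverse_conj n \<gamma>)"
    by (intro reverse_conj_mult) (simp_all add: left_divisors_def)
qed

theorem corollary6:
  fixes n :: nat
  assumes "n \<ge> 3"
  shows "semigroup_rank (left_divisors n 1) (map_mult n) = 2 * n - 3 \<and>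
         semigroup_rank (left_divisors n n) (map_mult n) = 2 * n - 3"
  using semigroup_rank_left_divisors_1[OF assms] semigroup_rank_left_divisors_reverse[of 1 n]
    assms by simp

end
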